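(* Let $f\in\mathcal{S}^*_B$, let $\Gamma_1,\Gamma_2,\Gamma_3,\dots$ be the logarithmic coefficients of the inverse function $f^{-1}$, and let $\mathcal{H}_{2,1}(F_{f^{-1}}/2)=\Gamma_1\Gamma_3-\Gamma_2^2$. Then $$|\mathcal{H}_{2,1}(F_{f^{-1}}/2)|\le\frac{43}{576}.$$ This inequality is sharp, i.e. equality holds for some function in $\mathcal{S}^*_B$.
   Context: Let $\mathbb{D}=\{z\in\mathbb{C}:|z|<1\}$ and let $\mathcal{A}$ be the class of analytic functions $f$ on $\mathbb{D}$ with $f(0)=0$, $f'(0)=1$, written $f(z)=z+\sum_{n=2}^\infty a_nz^n$. For analytic functions $g,h$ on $\mathbb{D}$, $g\prec h$ ($g$ is subordinate to $h$) means $g(z)=h(w(z))$ on $\mathbb{D}$ for some analytic $w:\mathbb{D}\to\mathbb{D}$ with $w(0)=0$. Let $B(z)=\dfrac{1}{1-\log(1+z)}$ on $\mathbb{D}$ (principal branch of the logarithm), and let $$\mathcal{S}^*_B=\left\{f\in\mathcal{A}:\ \frac{zf'(z)}{f(z)}\prec B(z)\right\}.$$ The inverse $f^{-1}$ is the local inverse of $f$ near the origin, and its logarithmic coefficients $\Gamma_n$ are defined by $F_{f^{-1}}(w)=\log\frac{f^{-1}(w)}{w}=2\sum_{n=1}^\infty\Gamma_nw^n$ for $w$ near $0$ (the branch vanishing at $w=0$). Thus $\Gamma_1=-\frac12a_2$, $\Gamma_2=-\frac12\left(a_3-\frac32a_2^2\right)$, $\Gamma_3=-\frac12\left(a_4-4a_2a_3+\frac{10}{3}a_2^3\right)$.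 *)

theory Defs
  imports "HOL-Complex_Analysis.Complex_Analysis"
begin

abbreviation unit_disc :: "complex set" where
  "unit_disc \<equiv> ball 0 1"

text \<open>Functions on the disc are total functions; their values outside the disc are irrelevant.\<close>

definition class_A :: "(complex \<Rightarrow> complex) set" where
  "class_A = {f. f holomorphic_on unit_disc \<and> f 0 = 0 \<and> deriv f 0 = 1}"

definition subordinate :: "(complex \<Rightarrow> complex) \<Rightarrow> (complex \<Rightarrow> complex) \<Rightarrow> bool" where
  "subordinate g h \<longleftrightarrow>
     (\<exists>w. w holomorphic_on unit_disc \<and> w ` unit_disc \<subseteq> unit_disc \<and> w 0 = 0 \<and>
          (\<forall>z\<in>unit_disc. g z = h (w z)))"

definition B_fun :: "complex \<Rightarrow> complex" where
  "B_fun z = 1 / (1 - Ln (1 + z))"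

text \<open>The quotient \<open>z f'(z) / f(z)\<close> has a removable singularity at the origin, where its
  value is \<open>1\<close>. That it is analytic elsewhere in the disc forces \<open>f\<close> to have no
  other zeros there; this is stated explicitly because division by zero is total.\<close>

definition log_quotient :: "(complex \<Rightarrow> complex) \<Rightarrow> complex \<Rightarrow> complex" where
  "log_quotient f z = (if z = 0 then 1 else z * deriv f z / f z)"

definition starlike_B :: "(complex \<Rightarrow> complex) set" where
  "starlike_B = {f \<in> class_A. (\<forall>z\<in>unit_disc - {0}. f z \<noteq> 0) \<and>
                               subordinate (log_quotient f) B_fun}"

definition local_inverse :: "(complex \<Rightarrow> complex) \<Rightarrow> (complex \<Rightarrow> complex) \<Rightarrow> bool" where
  "local_inverse f g \<longleftrightarrow>
     g analytic_on {0} \<and> g 0 = 0 \<and>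
     eventually (\<lambda>w. f (g w) = w) (nhds 0) \<and> eventually (\<lambda>z. g (f z) = z) (nhds 0)"

text \<open>For a local inverse \<open>g\<close> of a normalised function, \<open>g w / w\<close> tends to \<open>1\<close>, so near \<open>0\<close>
  the principal logarithm is the branch of \<open>log (g w / w)\<close> that vanishes at \<open>0\<close>.\<close>

definition log_ratio :: "(complex \<Rightarrow> complex) \<Rightarrow> complex \<Rightarrow> complex" where
  "log_ratio g w = (if w = 0 then 0 else Ln (g w / w))"

definition log_coeff :: "(complex \<Rightarrow> complex) \<Rightarrow> nat \<Rightarrow> complex" where
  "log_coeff g n = fps_nth (fps_expansion (log_ratio g) 0) n / 2"

definition hankel_2_1 :: "(nat \<Rightarrow> complex) \<Rightarrow> complex" where
  "hankel_2_1 \<Gamma> = \<Gamma> 1 * \<Gamma> 3 - (\<Gamma> 2)\<^sup>2"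

lemma local_inverse_exists:
  assumes "f \<in> class_A"
  shows "\<exists>g. local_inverse f g"
proof -
  have f: "f holomorphic_on unit_disc" "f 0 = 0" "deriv f 0 \<noteq> 0"
    using assms by (auto simp: class_A_def)
  obtain r where r: "r > 0" "ball 0 r \<subseteq> unit_disc" "inj_on f (ball 0 r)"
    using has_complex_derivative_locally_injective[OF f(1) _ _ f(3)] by auto
  have hol: "f holomorphic_on ball 0 r"
    using f(1) r(2) holomorphic_on_subset by blast
  obtain g where g: "g holomorphic_on (f ` ball 0 r)" "\<And>z. z \<in> ball 0 r \<Longrightarrow> g (f z) = z"
    using holomorphic_has_inverse[OF hol open_ball r(3)] by metis
  have op: "open (f ` ball 0 r)"
    using open_mapping_thm3[OF hol open_ball r(3)] .
  have 0: "0 \<in> f ` ball 0 r"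
    using f(2) r(1) by (metis centre_in_ball image_eqI)
  have "eventually (\<lambda>w. w \<in> f ` ball 0 r) (nhds 0)"
    using op 0 by (rule eventually_nhds_in_open)
  then have "eventually (\<lambda>w. f (g w) = w) (nhds 0)"
    by eventually_elim (use g(2) in auto)
  moreover have "eventually (\<lambda>z. z \<in> ball 0 r) (nhds (0::complex))"
    using r(1) by (intro eventually_nhds_in_open) auto
  then have "eventually (\<lambda>z. g (f z) = z) (nhds 0)"
    by eventually_elim (use g(2) in auto)
  moreover have "g analytic_on {0}"
    using g(1) op 0 analytic_at by blast
  moreover have "g 0 = 0"
    using g(2)[of 0] f(2) r(1) by simp
  ultimately show ?thesis
    unfolding local_inverse_def by blast
qed

lemma local_inverse_unique:
  assumes "local_inverse f g" "local_inverse f h"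
  shows "eventually (\<lambda>w. g w = h w) (nhds 0)"
proof -
  have "isCont h 0"
    using assms(2) analytic_at_imp_isCont by (auto simp: local_inverse_def)
  then have "filterlim h (nhds 0) (nhds 0)"
    using assms(2) by (simp add: local_inverse_def isCont_def tendsto_at_iff_tendsto_nhds)
  moreover have "eventually (\<lambda>z. g (f z) = z) (nhds 0)" "eventually (\<lambda>w. f (h w) = w) (nhds 0)"
    using assms by (auto simp: local_inverse_def)
  ultimately have "eventually (\<lambda>w. g (f (h w)) = h w) (nhds 0)" "eventually (\<lambda>w. f (h w) = w) (nhds 0)"
    by (auto simp: filterlim_iff)
  then show ?thesis
    by eventually_elim simp
qed

lemma log_coeff_unique:
  assumes "local_inverse f g" "local_inverse f h"
  shows "log_coeff g = log_coeff h"
proof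
  fix n
  have "eventually (\<lambda>w. log_ratio g w = log_ratio h w) (nhds 0)"
    using local_inverse_unique[OF assms] by eventually_elim (simp add: log_ratio_def)
  then have "(deriv ^^ n) (log_ratio g) 0 = (deriv ^^ n) (log_ratio h) 0"
    by (rule higher_deriv_cong_ev) simp
  then show "log_coeff g n = log_coeff h n"
    by (simp add: log_coeff_def fps_expansion_def)
qed

lemma log_coeff_sums:
  assumes "f \<in> class_A" "local_inverse f g"
  shows "eventually (\<lambda>w. (\<lambda>n. 2 * log_coeff g (Suc n) * w ^ Suc n) sums log_ratio g w) (nhds 0)"
proof -
  have g: "g analytic_on {0}" "g 0 = 0" "eventually (\<lambda>w. f (g w) = w) (nhds 0)"
    using assms(2) by (auto simp: local_inverse_def)
  have f: "f holomorphic_on unit_disc" "f 0 = 0" "deriv f 0 = 1"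
    using assms(1) by (auto simp: class_A_def)
  have df: "(f has_field_derivative 1) (at (g 0))"
    using holomorphic_derivI[OF f(1) open_ball, of 0] f(3) g(2) by simp
  have dg: "(g has_field_derivative deriv g 0) (at 0)"
    using g(1) analytic_on_imp_differentiable_at DERIV_deriv_iff_field_differentiable by blast
  have "((\<lambda>w. f (g w)) has_field_derivative 1 * deriv g 0) (at 0)"
    using DERIV_chain2[OF df dg] .
  moreover have "((\<lambda>w. f (g w)) has_field_derivative 1) (at 0)"
    using DERIV_cong_ev[OF refl g(3) refl] DERIV_ident by blast
  ultimately have dg0: "deriv g 0 = 1"
    using DERIV_unique by fastforce
  obtain S where S: "open S" "0 \<in> S" "g holomorphic_on S"
    using g(1) analytic_at by blast
  define h where "h = (\<lambda>z. if z = 0 then deriv g 0 else (g z - g 0) / (z - 0))"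
  have "h holomorphic_on S"
    unfolding h_def using S by (intro pole_lemma_open) auto
  then have "h analytic_on {0}"
    using S analytic_at by blast
  moreover have "h 0 = 1"
    by (simp add: h_def dg0)
  ultimately have "(\<lambda>w. Ln (h w)) analytic_on {0}"
    by (intro analytic_intros) auto
  moreover have eq: "log_ratio g = (\<lambda>w. Ln (h w))"
    by (auto simp: log_ratio_def h_def g(2) dg0)
  ultimately have "log_ratio g analytic_on {0}"
    by simp
  then have exp: "log_ratio g has_fps_expansion fps_expansion (log_ratio g) 0"
    by (rule analytic_at_imp_has_fps_expansion_0)
  let ?F = "fps_expansion (log_ratio g) 0"
  have 0: "fps_nth ?F 0 = 0"
    by (simp add: fps_expansion_def log_ratio_def)
  have "eventually (\<lambda>w. w \<in> eball 0 (fps_conv_radius ?F)) (nhds (0::complex))"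
    using exp by (intro eventually_nhds_in_open) (auto simp: has_fps_expansion_def zero_ereal_def)
  moreover have "eventually (\<lambda>w. eval_fps ?F w = log_ratio g w) (nhds 0)"
    using exp by (simp add: has_fps_expansion_def)
  ultimately show ?thesis
  proof eventually_elim
    case (elim w)
    have "(\<lambda>n. fps_nth ?F n * w ^ n) sums eval_fps ?F w"
      using elim(1) by (intro sums_eval_fps) auto
    then have "(\<lambda>n. fps_nth ?F (Suc n) * w ^ Suc n) sums log_ratio g w"
      using 0 elim(2) by (subst sums_Suc_iff) simp
    then show ?case
      by (simp add: log_coeff_def)
  qed
qed

end

(* Put z f'/f = B(w) with a Schwarz function w = c1 z + c2 z^2 + c3 z^3 + ... . Comparing coefficients
   in z f' (1 - log (1 + w)) = f and in f(z e^L) = z, where L = log (f^{-1}(z)/z), gives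
     576 H = 43 c1^4 - 60 c1^2 c2 - 36 c2^2 + 48 c1 c3.
   By two steps of the Schur algorithm c1 = a, c2 = (1 - u) x and
   c3 = (1 - u) ((1 - |x|^2) y - conj(a) x^2), where u = |a|^2 and a, x, y lie in the closed disc.
   After a rotation the modulus is at most |A - b x - g x^2| + d (1 - |x|^2) with A = 43 u^2,
   b = 60 u (1 - u), g = 12 (1 - u) (3 + u), d = 48 (1 - u) sqrt u. For small u the triangle
   inequality suffices; otherwise |A - b x - g x^2| <= (A + g |x|^2) sqrt (1 + b^2 / (4 A g)).
   Equality holds for w(z) = z, that is, c1 = 1 and c2 = c3 = 0. *)

theory Submission
  imports Defs
begin

section \<open>An identity for the modulus of a quadratic polynomial\<close>

text \<open>Dropping the second square bounds the modulus uniformly in the argument of \<open>x\<close>.\<close>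

lemma cmod_quadratic_identity:
  fixes A b g :: real and x :: complex
  shows "4 * A * g * (cmod (of_real A - of_real b * x - of_real g * x\<^sup>2))\<^sup>2
    + (4 * A * g * Re x + (A - g * (cmod x)\<^sup>2) * b)\<^sup>2
    = (4 * A * g + b\<^sup>2) * (A + g * (cmod x)\<^sup>2)\<^sup>2"
  unfolding cmod_power2 by (simp add: power2_eq_square) algebra

section \<open>Coefficient comparison in formal power series\<close>

text \<open>With \<open>F\<close> the series of f, \<open>fps_X * E\<close> is that of the inverse.
  The equation E' = L' E says that \<open>L\<close> is a logarithm of \<open>E\<close>, up to its
  constant term, and makes every comparison polynomial. The coefficients of \<open>L\<close> are 2
  \<Gamma>_n, so the factor 1/2 is absent.\<close>

lemma fps_inverse_log_coeffs:
  fixes F E L :: "complex fps"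
  assumes F: "fps_nth F 0 = 0" "fps_nth F 1 = 1" and E: "fps_nth E 0 = 1"
    and comp: "F oo (fps_X * E) = fps_X"
    and L: "fps_deriv E = fps_deriv L * E"
  defines "a2 \<equiv> fps_nth F 2" and "a3 \<equiv> fps_nth F 3" and "a4 \<equiv> fps_nth F 4"
  shows "fps_nth L 1 = - a2"
    and "fps_nth L 2 = - (a3 - 3 / 2 * a2\<^sup>2)"
    and "fps_nth L 3 = - (a4 - 4 * a2 * a3 + 10 / 3 * a2 ^ 3)"
proof -
  define e1 e2 e3 where "e1 = fps_nth E 1" and "e2 = fps_nth E 2" and "e3 = fps_nth E 3"
  note d = F E e1_def[symmetric] e2_def[symmetric] e3_def[symmetric]
    a2_def[symmetric] a3_def[symmetric] a4_def[symmetric]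
  note s = fps_compose_nth fps_mult_nth fps_X_nth power_0 power_Suc eval_nat_numeral atLeast0_atMost_Suc fps_X_mult_nth
  have E': "fps_nth E (Suc 0) = e1" "fps_nth E (Suc (Suc 0)) = e2" "fps_nth E (Suc (Suc (Suc 0))) = e3"
     "fps_nth F (Suc 0) = 1" "fps_nth F (Suc (Suc 0)) = a2" "fps_nth F (Suc (Suc (Suc 0))) = a3"
     "fps_nth F (Suc (Suc (Suc (Suc 0)))) = a4"
    using F by (simp_all add: a2_def a3_def a4_def e1_def e2_def e3_def eval_nat_numeral)
  have c: "fps_nth (F oo (fps_X * E)) n = fps_nth fps_X n" for n using comp by simp
  have 2: "e1 + a2 = 0"
    using c[of 2] by (simp add: s E' F E algebra_simps)
  have 3: "e2 + 2 * a2 * e1 + a3 = 0"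
    using c[of 3] by (simp add: s E' F E algebra_simps)
  have 4: "e3 + a2 * (2 * e2 + e1\<^sup>2) + 3 * a3 * e1 + a4 = 0"
    using c[of 4] by (simp add: s E' F E algebra_simps)
  have l: "fps_nth (fps_deriv E) n = fps_nth (fps_deriv L * E) n" for n using L by simp
  define l1 l2 l3 where "l1 = fps_nth L 1" and "l2 = fps_nth L 2" and "l3 = fps_nth L 3"
  have L': "fps_nth L (Suc 0) = l1" "fps_nth L (Suc (Suc 0)) = l2" "fps_nth L (Suc (Suc (Suc 0))) = l3"
    by (simp_all add: l1_def l2_def l3_def eval_nat_numeral)
  have "e1 = l1"
    using l[of 0] by (simp add: s E' L' F E)
  moreover have "2 * e2 = 2 * l2 + l1 * e1"
    using l[of 1] by (simp add: s E' L' F E algebra_simps)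
  moreover have "3 * e3 = 3 * l3 + 2 * l2 * e1 + l1 * e2"
    using l[of 2] by (simp add: s E' L' F E algebra_simps)
  ultimately have *: "e1 = l1" "2 * e2 = 2 * l2 + l1 * e1" "3 * e3 = 3 * l3 + 2 * l2 * e1 + l1 * e2"
    by blast+
  \<comment> \<open>The multiples 2 and 3 come from differentiating; keeping them avoids fractions
    until the end.\<close>
  have "l1 = - a2" using 2 * by algebra
  moreover have "2 * l2 = - 2 * a3 + 3 * a2\<^sup>2" using 2 3 * by algebra
  moreover have "3 * l3 = - 3 * a4 + 12 * a2 * a3 - 10 * a2 ^ 3"
    using 2 3 4 * by algebra
  ultimately show "fps_nth L 1 = - a2"
    "fps_nth L 2 = - (a3 - 3 / 2 * a2\<^sup>2)"
    "fps_nth L 3 = - (a4 - 4 * a2 * a3 + 10 / 3 * a2 ^ 3)"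
    unfolding l1_def l2_def l3_def by (simp_all add: field_simps)
qed

text \<open>Here \<open>K\<close> is the series of \<open>log (1 + w)\<close>.\<close>

lemma fps_starlike_coeffs:
  fixes F K W :: "complex fps"
  assumes F: "fps_nth F 0 = 0" "fps_nth F 1 = 1" and K: "fps_nth K 0 = 0" and W: "fps_nth W 0 = 0"
    and FK: "fps_X * fps_deriv F * (1 - K) = F"
    and KW: "fps_deriv K * (1 + W) = fps_deriv W"
  defines "c1 \<equiv> fps_nth W 1" and "c2 \<equiv> fps_nth W 2" and "c3 \<equiv> fps_nth W 3"
  shows "fps_nth F 2 = c1"
    and "fps_nth F 3 = c2 / 2 + 3 / 4 * c1\<^sup>2"
    and "fps_nth F 4 = c3 / 3 + 5 / 6 * c1 * c2 + 19 / 36 * c1 ^ 3"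
proof -
  define k1 k2 k3 where "k1 = fps_nth K 1" and "k2 = fps_nth K 2" and "k3 = fps_nth K 3"
  define a2 a3 a4 where "a2 = fps_nth F 2" and "a3 = fps_nth F 3" and "a4 = fps_nth F 4"
  have n: "fps_nth K (Suc 0) = k1" "fps_nth K (Suc (Suc 0)) = k2" "fps_nth K (Suc (Suc (Suc 0))) = k3"
     "fps_nth F (Suc 0) = 1" "fps_nth F (Suc (Suc 0)) = a2" "fps_nth F (Suc (Suc (Suc 0))) = a3"
     "fps_nth F (Suc (Suc (Suc (Suc 0)))) = a4" "fps_nth W (Suc 0) = c1" "fps_nth W (Suc (Suc 0)) = c2"
     "fps_nth W (Suc (Suc (Suc 0))) = c3"
    using F by (simp_all add: a2_def a3_def a4_def k1_def k2_def k3_def c1_def c2_def c3_def eval_nat_numeral)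
  note s = fps_mult_nth eval_nat_numeral atLeast0_atMost_Suc fps_X_mult_nth n F K W
  have c: "fps_nth (fps_X * fps_deriv F * (1 - K)) n = fps_nth F n" for n using FK by simp
  have l: "fps_nth (fps_deriv K * (1 + W)) n = fps_nth (fps_deriv W) n" for n using KW by simp
  \<comment> \<open>Degree n of the first equation determines (n - 1) a_n from lower coefficients
    and the k_j; the second one, the derivative of log (1 + w) cleared of its denominator,
    determines the k_j.\<close>
  have "2 * a2 - k1 = a2"
    using c[of 2] by (simp add: s)
  moreover have "3 * a3 - 2 * a2 * k1 - k2 = a3"
    using c[of 3] by (simp add: s algebra_simps)
  moreover have "4 * a4 - 3 * a3 * k1 - 2 * a2 * k2 - k3 = a4"
    using c[of 4] by (simp add: s algebra_simps)
  moreover have "k1 = c1"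
    using l[of 0] by (simp add: s)
  moreover have "2 * k2 + k1 * c1 = 2 * c2"
    using l[of 1] by (simp add: s algebra_simps)
  moreover have "3 * k3 + 2 * k2 * c1 + k1 * c2 = 3 * c3"
    using l[of 2] by (simp add: s algebra_simps)
  ultimately have *: "2 * a2 - k1 = a2" "3 * a3 - 2 * a2 * k1 - k2 = a3"
    "4 * a4 - 3 * a3 * k1 - 2 * a2 * k2 - k3 = a4" "k1 = c1" "2 * k2 + k1 * c1 = 2 * c2"
    "3 * k3 + 2 * k2 * c1 + k1 * c2 = 3 * c3"
    by blast+
  have "a2 - k1 = (2 * a2 - k1) - a2" by simp
  then have a2: "a2 = c1" unfolding *(1) by (simp add: *(4))
  have k2: "k2 = c2 - c1\<^sup>2 / 2" using *(5) unfolding *(4) by (simp add: field_simps power2_eq_square)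
  have "k3 = c3 - (2 * k2 * c1 + k1 * c2) / 3" using *(6) by (simp add: field_simps)
  also have "\<dots> = c3 - c1 * c2 + c1 ^ 3 / 3"
    unfolding *(4) k2 by (simp add: field_simps power2_eq_square power3_eq_cube)
  finally have k3: "k3 = c3 - c1 * c2 + c1 ^ 3 / 3" .
  have "2 * a3 - (2 * a2 * k1 + k2) = (3 * a3 - 2 * a2 * k1 - k2) - a3" by simp
  then have "2 * a3 = 2 * a2 * k1 + k2" unfolding *(2) by simp
  then have a3: "a3 = c2 / 2 + 3 / 4 * c1\<^sup>2"
    unfolding a2 *(4) k2 by (simp add: field_simps power2_eq_square)
  have "3 * a4 - (3 * a3 * k1 + 2 * a2 * k2 + k3) = (4 * a4 - 3 * a3 * k1 - 2 * a2 * k2 - k3) - a4" by simp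
  then have 3: "3 * a4 = 3 * a3 * k1 + 2 * a2 * k2 + k3" unfolding *(3) by simp
  have "a4 = 3 * a4 / 3" by simp
  also have "\<dots> = c3 / 3 + 5 / 6 * c1 * c2 + 19 / 36 * c1 ^ 3"
    unfolding 3 unfolding a2 a3 *(4) k2 k3 by (simp add: field_simps power2_eq_square power3_eq_cube)
  finally have "a4 = c3 / 3 + 5 / 6 * c1 * c2 + 19 / 36 * c1 ^ 3" .
  with a2 a3 show "fps_nth F 2 = c1"
    "fps_nth F 3 = c2 / 2 + 3 / 4 * c1\<^sup>2"
    "fps_nth F 4 = c3 / 3 + 5 / 6 * c1 * c2 + 19 / 36 * c1 ^ 3"
    unfolding a2_def a3_def a4_def by blast+
qed

section \<open>The extremal problem in real parameters\<close>

text \<open>This is (A + g)^2 k^2 \<le> 43^2 with the denominator of k^2 = 1 + b^2 / (4 A g)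
  cleared. Equality holds at u = 1.\<close>

lemma cubic_bound:
  fixes u :: real
  assumes "1 / 5 \<le> u" "u \<le> 1"
  shows "(31 * u\<^sup>2 - 24 * u + 36)\<^sup>2 * (204 - 32 * u) \<le> 43\<^sup>2 * (43 * (3 + u))"
proof -
  define P where "P = 31 * u\<^sup>2 - 24 * u + 36"
  \<comment> \<open>The convex quadratic \<open>P\<close> lies below its chord over
    [1/5, 1].\<close>
  have "0 \<le> (5 * u - 1) * (1 - u)" using assms by (intro mult_nonneg_nonneg) auto
  then have "5 * P \<le> 66 * u + 149"
    by (simp add: P_def power2_eq_square algebra_simps)
  \<comment> \<open>Completing the square: 31 P = (31 u - 12)^2 + 972. The sign of \<open>P\<close>
    is needed to square the chord bound.\<close>
  moreover have "0 \<le> (31 * u - 12)\<^sup>2" by simp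
  then have "0 \<le> P" by (simp add: P_def power2_eq_square algebra_simps)
  ultimately have "(5 * P)\<^sup>2 \<le> (66 * u + 149)\<^sup>2"
    by (intro power_mono) auto
  then have "(5 * P)\<^sup>2 * (204 - 32 * u) \<le> (66 * u + 149)\<^sup>2 * (204 - 32 * u)"
    using assms by (intro mult_right_mono) auto
  also have "\<dots> \<le> 25 * (43\<^sup>2 * (43 * (3 + u)))"
  proof -
    have "u\<^sup>2 \<le> 1" using assms by (simp add: power_le_one)
    \<comment> \<open>The difference of the two sides vanishes at u = 1; this is its
      factorisation.\<close>
    then have "0 \<le> (1 - u) * (1434021 + 119856 * u - 139392 * u\<^sup>2)"
      using assms by (intro mult_nonneg_nonneg) auto
    then show ?thesis by (simp add: power2_eq_square algebra_simps)
  qed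
  finally have "25 * (P\<^sup>2 * (204 - 32 * u)) \<le> 25 * (43\<^sup>2 * (43 * (3 + u)))"
    by (simp add: power_mult_distrib)
  then show ?thesis unfolding P_def by (rule mult_left_le_imp_le) simp
qed

text \<open>This is what remains once the parameter y, which enters linearly, has been given its
  largest modulus. Replacing a by e a and x by e^2 x with |e| = 1 only multiplies the quadratic
  expression by e^4, so a may be taken real and nonnegative.\<close>

lemma quadratic_schur_bound:
  fixes a x :: complex
  assumes a: "cmod a \<le> 1" and x: "cmod x \<le> 1"
  defines "u \<equiv> (cmod a)\<^sup>2"
  shows "cmod (43 * a ^ 4 - 60 * (1 - of_real u) * a\<^sup>2 * x - 12 * (1 - of_real u) * (3 + of_real u) * x\<^sup>2)
    + 48 * (1 - u) * cmod a * (1 - (cmod x)\<^sup>2) \<le> 43"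
proof -
  have u: "0 \<le> u" "u \<le> 1" using a by (auto simp: u_def power_le_one)
  define A b g d where "A = 43 * u\<^sup>2" and "b = 60 * u * (1 - u)"
    and "g = 12 * (1 - u) * (3 + u)" and "d = 48 * (1 - u) * cmod a"
  have nn: "0 \<le> A" "0 \<le> b" "0 \<le> g" "0 \<le> d"
    using u by (auto simp: A_def b_def g_def d_def intro!: mult_nonneg_nonneg)
  have dg: "d \<le> g"
  proof -
    have "0 \<le> (1 - cmod a) * (3 - cmod a)" using a by (intro mult_nonneg_nonneg) auto
    then have "4 * cmod a \<le> 3 + u" by (simp add: u_def power2_eq_square algebra_simps)
    then have "12 * (1 - u) * (4 * cmod a) \<le> 12 * (1 - u) * (3 + u)"
      using u by (intro mult_left_mono) auto
    then show ?thesis unfolding d_def g_def by (simp add: algebra_simps)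
  qed
  define X where "X = (cmod x)\<^sup>2"
  have X: "0 \<le> X" "X \<le> 1" using x by (auto simp: X_def power_le_one)
  \<comment> \<open>The phase of \<open>a\<close>. Since \<open>sgn 0 = 0\<close>, the value 1 is
    chosen for a = 0 to keep |e| = 1.\<close>
  define e where "e = (if a = 0 then 1 else sgn a)"
  have e: "cmod e = 1" "a = cmod a * e" by (auto simp: e_def norm_sgn) (simp add: sgn_eq)
  define x' where "x' = x / e\<^sup>2"
  have x': "cmod x' = cmod x" "x = x' * e\<^sup>2"
    using e(1) by (auto simp: x'_def norm_divide norm_power)
  have "43 * a ^ 4 - 60 * (1 - of_real u) * a\<^sup>2 * x - 12 * (1 - of_real u) * (3 + of_real u) * x\<^sup>2
      = e ^ 4 * (of_real A - of_real b * x' - of_real g * x'\<^sup>2)"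
  proof -
    have "a\<^sup>2 = of_real u * e\<^sup>2"
      using e(2) by (metis power_mult_distrib of_real_power u_def)
    then show ?thesis
      unfolding A_def b_def g_def of_real_mult of_real_diff of_real_add of_real_power of_real_numeral of_real_1
      using x'(2) by algebra
  qed
  then have eq: "cmod (43 * a ^ 4 - 60 * (1 - of_real u) * a\<^sup>2 * x - 12 * (1 - of_real u) * (3 + of_real u) * x\<^sup>2)
      = cmod (of_real A - of_real b * x' - of_real g * x'\<^sup>2)" (is "_ = ?T")
    by (simp add: norm_mult norm_power e(1))
  have "?T + d * (1 - X) \<le> 43"
  \<comment> \<open>In both cases the bound is monotone in \<open>X\<close> because \<open>d \<le> g\<close>, so that the worst case is \<open>X = 1\<close>.
    The triangle inequality alone fails for \<open>u\<close> near \<open>1\<close>.\<close>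
  proof (cases "u \<le> 1 / 5 \<or> u = 1")
    case True
    have "?T \<le> A + b * cmod x + g * X"
      using norm_triangle_ineq4[of "of_real A - of_real b * x'" "of_real g * x'\<^sup>2"]
        norm_triangle_ineq4[of "of_real A" "of_real b * x'"] nn
      by (simp add: norm_mult norm_power x'(1) X_def)
    moreover have "b * cmod x \<le> b" using nn x by (simp add: mult_left_le)
    moreover have "d * (1 - X) \<le> g * (1 - X)" using dg X by (intro mult_right_mono) auto
    ultimately have "?T + d * (1 - X) \<le> A + b + g" by (simp add: algebra_simps)
    also have "A + b + g = 36 + 36 * u - 29 * u\<^sup>2"
      by (simp add: A_def b_def g_def power2_eq_square algebra_simps)
    also have "\<dots> \<le> 43"
    proof (cases "u = 1")
      case False
      then have "u \<le> 1 / 5" using True by simp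
      \<comment> \<open>The tangent of 29 u^2 at u = 1/5 turns the bound into an increasing linear
        function of u, whose value at 1/5 is 42.04.\<close>
      moreover have "0 \<le> 29 * (5 * u - 1)\<^sup>2" by simp
      then have "290 * u \<le> 725 * u\<^sup>2 + 29" by (simp add: power2_eq_square algebra_simps)
      ultimately show ?thesis by linarith
    qed simp
    finally show ?thesis .
  next
    case False
    then have u': "1 / 5 \<le> u" "u < 1" using u by auto
    \<comment> \<open>Both are divisors below. As \<open>g\<close> vanishes at u = 1, that value
      belongs to the other case.\<close>
    have pos: "0 < A" "0 < g" using u' by (auto simp: A_def g_def)
    \<comment> \<open>The factor left when \<open>cmod_quadratic_identity\<close> is divided by 4 A
      g and its second square is dropped.\<close>
    define k where "k = sqrt (1 + b\<^sup>2 / (4 * A * g))"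
    have k2: "k\<^sup>2 = 1 + b\<^sup>2 / (4 * A * g)"
      unfolding k_def using pos by (intro real_sqrt_pow2 add_nonneg_nonneg) auto
    have k1: "1 \<le> k" using pos by (simp add: k_def)
    have "?T\<^sup>2 \<le> (k * (A + g * X))\<^sup>2"
    proof -
      have "4 * A * g * ?T\<^sup>2 \<le> (4 * A * g + b\<^sup>2) * (A + g * X)\<^sup>2"
        unfolding X_def x'(1)[symmetric] cmod_quadratic_identity[of A g b x', symmetric]
        by (simp only: le_add_same_cancel1 zero_le_power2)
      also have "\<dots> = 4 * A * g * (k * (A + g * X))\<^sup>2"
      proof -
        have "4 * A * g + b\<^sup>2 = 4 * A * g * k\<^sup>2"
          using pos by (simp add: k2 field_simps)
        then show ?thesis by (simp add: power_mult_distrib)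
      qed
      finally show ?thesis using pos by simp
    qed
    then have "?T \<le> k * (A + g * X)"
      by (rule power2_le_imp_le) (use k1 nn X in auto)
    \<comment> \<open>With \<open>k * g\<close> in place of \<open>d\<close>, the variable
      \<open>X\<close> cancels from the sum.\<close>
    moreover have "d * (1 - X) \<le> k * g * (1 - X)"
    proof (intro mult_right_mono)
      have "1 * g \<le> k * g" using k1 nn by (intro mult_right_mono) auto
      then show "d \<le> k * g" using dg by simp
    qed (use X in auto)
    ultimately have "?T + d * (1 - X) \<le> k * (A + g)" by (simp add: algebra_simps)
    also have "\<dots> \<le> 43"
    proof (rule power2_le_imp_le)
      have "k\<^sup>2 = (204 - 32 * u) / (43 * (3 + u))"
      proof -
        \<comment> \<open>The common factor u^2 (1 - u) of b^2 and 4 A g cancels, so k^2 is a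
          quotient of linear functions.\<close>
        have "b\<^sup>2 * (43 * (3 + u)) = 75 * (1 - u) * (4 * A * g)"
          by (simp add: A_def b_def g_def power2_eq_square algebra_simps)
        then have "b\<^sup>2 / (4 * A * g) = 75 * (1 - u) / (43 * (3 + u))"
          using pos u' by (simp add: frac_eq_eq)
        then have "k\<^sup>2 = 1 + 75 * (1 - u) / (43 * (3 + u))" by (simp only: k2)
        then show ?thesis using u' by (simp add: field_simps)
      qed
      moreover have "A + g = 31 * u\<^sup>2 - 24 * u + 36"
        by (simp add: A_def g_def power2_eq_square algebra_simps)
      ultimately have "(k * (A + g))\<^sup>2 = (31 * u\<^sup>2 - 24 * u + 36)\<^sup>2 * (204 - 32 * u) / (43 * (3 + u))"
        by (simp add: power_mult_distrib)
      also have "\<dots> \<le> 43\<^sup>2"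
        using cubic_bound[of u] u' by (simp add: divide_le_eq)
      finally show "(k * (A + g))\<^sup>2 \<le> 43\<^sup>2" .
    qed simp
    finally show ?thesis .
  qed
  then show ?thesis unfolding eq d_def X_def by (simp only: mult_ac)
qed

section \<open>Schwarz functions and the Schur algorithm\<close>

text \<open>The Schwarz lemma bounds f(z)/z away from 0, and its bound on f'(0) covers the removable
  singularity. The bound on \<open>h\<close> cannot be strict: for a rotation, \<open>h\<close> is a
  unimodular constant.\<close>

lemma Schwarz_quotient:
  assumes hol: "f holomorphic_on unit_disc" and f0: "f 0 = 0"
    and bd: "\<And>z. z \<in> unit_disc \<Longrightarrow> cmod (f z) < 1"
  obtains h where "h holomorphic_on unit_disc" "\<And>z. z \<in> unit_disc \<Longrightarrow> cmod (h z) \<le> 1"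
    "\<And>z. z \<in> unit_disc \<Longrightarrow> f z = z * h z"
proof -
  obtain h where h: "h holomorphic_on unit_disc" "\<And>z. cmod z < 1 \<Longrightarrow> f z = z * h z" "deriv f 0 = h 0"
    using Schwarz3[OF hol f0] by metis
  have S: "cmod (f z) \<le> cmod z" "cmod (deriv f 0) \<le> 1" if "z \<in> unit_disc" for z
    using Schwarz_Lemma(1,2)[OF hol f0, of z] bd that by auto
  have "cmod (h z) \<le> 1" if z: "z \<in> unit_disc" for z
  proof (cases "z = 0")
    case False
    then show ?thesis using S(1)[OF z] z h(2)[of z] by (simp add: norm_mult)
  qed (use S(2)[OF z] h(3) in simp)
  then show ?thesis using that[OF h(1)] h(2) by (metis mem_ball_0)
qed

text \<open>The form without a quotient also covers \<open>\<bar>f 0\<bar> = 1\<close>, where \<open>f\<close> is constant and \<open>h = 0\<close> works.\<close>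

lemma schur_step:
  assumes hol: "f holomorphic_on unit_disc" and bd: "\<And>z. z \<in> unit_disc \<Longrightarrow> cmod (f z) \<le> 1"
  obtains h where "h holomorphic_on unit_disc" "\<And>z. z \<in> unit_disc \<Longrightarrow> cmod (h z) \<le> 1"
    "\<And>z. z \<in> unit_disc \<Longrightarrow> f z - f 0 = z * h z * (1 - cnj (f 0) * f z)"
proof (cases "\<forall>z\<in>unit_disc. cmod (f z) < 1")
  case False
  then obtain z where z: "z \<in> unit_disc" "cmod (f z) = 1"
    using bd by force
  have "f constant_on unit_disc"
    by (rule maximum_modulus_principle[OF hol open_ball _ open_ball order_refl z(1)]) (use z bd in auto)
  then obtain b where b: "f w = b" if "w \<in> unit_disc" for w
    unfolding constant_on_def by blast
  show ?thesis
    by (rule that[of "\<lambda>_. 0"]) (simp_all add: b)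
next
  case True
  define a where "a = f 0"
  have a: "cmod a < 1" using True by (simp add: a_def)
  have nz: "1 - cnj a * f z \<noteq> 0" if "z \<in> unit_disc" for z
  proof -
    have "cmod a * cmod (f z) \<le> cmod a * 1"
      using True that by (intro mult_left_mono) (auto intro: less_imp_le)
    then have "cmod (cnj a * f z) < 1" using a by (simp add: norm_mult)
    then show ?thesis by auto
  qed
  \<comment> \<open>The disc automorphism that sends f(0) to 0 is applied to f. The result is
    divisible by z, and clearing the denominator gives the required identity.\<close>
  define m where "m z = (f z - a) / (1 - cnj a * f z)" for z
  have m: "m holomorphic_on unit_disc" "m 0 = 0"
    unfolding m_def using hol nz by (auto intro!: holomorphic_intros simp: a_def)
  have "cmod (m z) < 1" if "cmod z < 1" for z
    using Moebius_function_norm_lt_1[of a "f z" 0] a True that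
    by (simp add: m_def Moebius_function_def)
  then obtain h where h: "h holomorphic_on unit_disc" "\<And>z. z \<in> unit_disc \<Longrightarrow> cmod (h z) \<le> 1"
      "\<And>z. z \<in> unit_disc \<Longrightarrow> m z = z * h z"
    using Schwarz_quotient[OF m] by (metis mem_ball_0)
  show ?thesis
  proof (rule that[of h])
    fix z assume z: "z \<in> unit_disc"
    show "f z - f 0 = z * h z * (1 - cnj (f 0) * f z)"
      using h(3)[OF z] nz[OF z] unfolding m_def a_def[symmetric] by (simp add: divide_eq_eq)
  qed (fact h)+
qed

lemma fps_eq_if_eq_on_disc:
  fixes F G :: "complex fps"
  assumes "f has_fps_expansion F" "g has_fps_expansion G"
    and "\<And>z. z \<in> unit_disc \<Longrightarrow> f z = g z"
  shows "F = G"
proof -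
  have "eventually (\<lambda>z. f z = g z) (nhds 0)"
    by (rule eventually_mono[OF eventually_nhds_in_open[of unit_disc]]) (use assms(3) in auto)
  then have "g has_fps_expansion F"
    using has_fps_expansion_cong[OF _ refl] assms(1) by blast
  then show ?thesis using fps_expansion_unique_complex assms(2) by blast
qed

lemma schur_step_fps:
  assumes hol: "f holomorphic_on unit_disc" and bd: "\<And>z. z \<in> unit_disc \<Longrightarrow> cmod (f z) \<le> 1"
  obtains h H where "h holomorphic_on unit_disc" "\<And>z. z \<in> unit_disc \<Longrightarrow> cmod (h z) \<le> 1"
    "h has_fps_expansion H"
    "fps_expansion f 0 - fps_const (f 0) = fps_X * H * (1 - fps_const (cnj (f 0)) * fps_expansion f 0)"
proof -
  obtain h where h: "h holomorphic_on unit_disc" "\<And>z. z \<in> unit_disc \<Longrightarrow> cmod (h z) \<le> 1"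
    "\<And>z. z \<in> unit_disc \<Longrightarrow> f z - f 0 = z * h z * (1 - cnj (f 0) * f z)"
    using schur_step[OF assms] by metis
  have F: "f has_fps_expansion fps_expansion f 0" and H: "h has_fps_expansion fps_expansion h 0"
    using hol h(1) by (auto intro!: has_fps_expansion_fps_expansion[of unit_disc])
  have "fps_expansion f 0 - fps_const (f 0)
      = fps_X * fps_expansion h 0 * (1 - fps_const (cnj (f 0)) * fps_expansion f 0)"
  proof (rule fps_eq_if_eq_on_disc)
    show "(\<lambda>z. f z - f 0) has_fps_expansion fps_expansion f 0 - fps_const (f 0)"
      by (intro fps_expansion_intros F)
    show "(\<lambda>z. z * h z * (1 - cnj (f 0) * f z)) has_fps_expansion
        fps_X * fps_expansion h 0 * (1 - fps_const (cnj (f 0)) * fps_expansion f 0)"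
      by (intro fps_expansion_intros F H)
  qed (rule h(3))
  then show ?thesis using that h H by blast
qed

text \<open>The parameters a, x, y are the values at 0 of p = w/z and of its first and second Schur
  transforms h and k. Comparing low coefficients in the two Schur identities gives the
  formulas.\<close>

lemma schwarz_coeffs:
  assumes hol: "w holomorphic_on unit_disc" and im: "w ` unit_disc \<subseteq> unit_disc" and w0: "w 0 = 0"
  obtains a x y :: complex where "cmod a \<le> 1" "cmod x \<le> 1" "cmod y \<le> 1"
    "fps_nth (fps_expansion w 0) 1 = a"
    "fps_nth (fps_expansion w 0) 2 = (1 - (cmod a)\<^sup>2) * x"
    "fps_nth (fps_expansion w 0) 3 = (1 - (cmod a)\<^sup>2) * ((1 - (cmod x)\<^sup>2) * y - cnj a * x\<^sup>2)"
proof -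
  obtain p where p: "p holomorphic_on unit_disc" "\<And>z. z \<in> unit_disc \<Longrightarrow> cmod (p z) \<le> 1"
      "\<And>z. z \<in> unit_disc \<Longrightarrow> w z = z * p z"
    using Schwarz_quotient[OF hol w0] im by (metis image_subset_iff mem_ball_0)
  obtain h H where h: "h holomorphic_on unit_disc" "\<And>z. z \<in> unit_disc \<Longrightarrow> cmod (h z) \<le> 1"
    and H: "h has_fps_expansion H"
      "fps_expansion p 0 - fps_const (p 0) = fps_X * H * (1 - fps_const (cnj (p 0)) * fps_expansion p 0)"
    using schur_step_fps[OF p(1,2)] by metis
  obtain k K where k: "\<And>z. z \<in> unit_disc \<Longrightarrow> cmod (k z) \<le> 1"
    and K: "k has_fps_expansion K"
      "fps_expansion h 0 - fps_const (h 0) = fps_X * K * (1 - fps_const (cnj (h 0)) * fps_expansion h 0)"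
    using schur_step_fps[OF h] by metis
  have H_eq: "fps_expansion h 0 = H"
    by (rule fps_eq_if_eq_on_disc[OF _ H(1)]) (use h(1) in \<open>auto intro!: has_fps_expansion_fps_expansion[of unit_disc]\<close>)
  define P where "P = fps_expansion p 0"
  have P: "p has_fps_expansion P"
    unfolding P_def using p(1) by (auto intro!: has_fps_expansion_fps_expansion[of unit_disc])
  \<comment> \<open>This shifts indices by one: the coefficients 1, 2, 3 of w are the coefficients
    0, 1, 2 of p.\<close>
  have W: "fps_expansion w 0 = fps_X * P"
  proof (rule fps_eq_if_eq_on_disc)
    show "w has_fps_expansion fps_expansion w 0"
      using hol by (auto intro!: has_fps_expansion_fps_expansion[of unit_disc])
    show "(\<lambda>z. z * p z) has_fps_expansion fps_X * P"
      by (intro fps_expansion_intros P)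
  qed (rule p(3))
  have 0: "fps_nth P 0 = p 0" "fps_nth H 0 = h 0" "fps_nth K 0 = k 0"
    using P H(1) K(1) by (auto dest: has_fps_expansion_imp_0_eq_fps_nth_0)
  note s = fps_mult_nth eval_nat_numeral atLeast0_atMost_Suc fps_X_mult_nth 0 mult.assoc
  have cP: "fps_nth (P - fps_const (p 0)) n = fps_nth (fps_X * (H * (1 - fps_const (cnj (p 0)) * P))) n" for n
    using H(2) by (simp add: P_def mult.assoc)
  have cH: "fps_nth (H - fps_const (h 0)) n = fps_nth (fps_X * (K * (1 - fps_const (cnj (h 0)) * H))) n" for n
    using K(2) by (simp add: H_eq mult.assoc)
  have n: "of_real (1 - (cmod z)\<^sup>2) = 1 - z * cnj z" for z
    using complex_norm_square[of z] by simp
  have P1: "fps_nth P 1 = of_real (1 - (cmod (p 0))\<^sup>2) * h 0"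
    unfolding n using cP[of 1] by (simp add: s algebra_simps)
  have H1: "fps_nth H 1 = of_real (1 - (cmod (h 0))\<^sup>2) * k 0"
    unfolding n using cH[of 1] by (simp add: s algebra_simps)
  have "fps_nth P 2 = of_real (1 - (cmod (p 0))\<^sup>2) * fps_nth H 1 - h 0 * cnj (p 0) * fps_nth P 1"
    unfolding n using cP[of 2] by (simp add: s algebra_simps)
  then have P2: "fps_nth P 2 = of_real (1 - (cmod (p 0))\<^sup>2)
      * (of_real (1 - (cmod (h 0))\<^sup>2) * k 0 - cnj (p 0) * (h 0)\<^sup>2)"
    unfolding P1 H1 by (simp add: power2_eq_square algebra_simps)
  show ?thesis
    by (rule that[of "p 0" "h 0" "k 0"]) (use p h k P1 P2 0 in \<open>simp_all add: W fps_X_mult_nth numeral_eq_Suc\<close>)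
qed

section \<open>The Hankel determinant of a function in the class\<close>

text \<open>These facts make log (1 + w) and B(w) analytic. The number 1 + u has positive real part,
  and log (1 + u) = 1 would require |1 + u| = e, although |1 + u| < 2 < e.\<close>

lemma Ln_one_plus:
  assumes "cmod u < 1"
  shows "1 + u \<notin> \<real>\<^sub>\<le>\<^sub>0" and "Ln (1 + u) \<noteq> 1"
proof -
  have "\<bar>Re u\<bar> < 1" using abs_Re_le_cmod[of u] assms by linarith
  then have "0 < Re (1 + u)" by simp
  then show *: "1 + u \<notin> \<real>\<^sub>\<le>\<^sub>0" by (metis complex_nonpos_Reals_iff not_less)
  show "Ln (1 + u) \<noteq> 1"
  proof
    assume "Ln (1 + u) = 1"
    then have "exp 1 = 1 + u" using * by (metis exp_Ln nonpos_Reals_zero_I)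
    then have "exp (1::real) = cmod (1 + u)" by (metis norm_exp_eq_Re one_complex.simps(1))
    moreover have "cmod (1 + u) < 2" using norm_triangle_ineq[of 1 u] assms by simp
    moreover have "2 \<le> exp (1::real)" using exp_ge_add_one_self[of 1] by simp
    ultimately show False by simp
  qed
qed

text \<open>Three identities of germs at 0 are turned into series: z f' (1 - log (1 + w)) = f, the
  differential equation of log (1 + w), and f(g(z)) = z with g(z) = z e^L. The coefficient lemmas
  then express each \<Gamma>_n through the coefficients of w.\<close>

lemma hankel_eq:
  assumes f: "f \<in> class_A" "\<forall>z\<in>unit_disc - {0}. f z \<noteq> 0" and g: "local_inverse f g"
    and w: "w holomorphic_on unit_disc" "w ` unit_disc \<subseteq> unit_disc" "w 0 = 0"
    and fw: "\<forall>z\<in>unit_disc. log_quotient f z = B_fun (w z)"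
  defines "c \<equiv> fps_nth (fps_expansion w 0)"
  shows "hankel_2_1 (log_coeff g)
    = (48 * c 1 * c 3 - 60 * (c 1)\<^sup>2 * c 2 - 36 * (c 2)\<^sup>2 + 43 * c 1 ^ 4) / 576"
proof -
  have f': "f holomorphic_on unit_disc" "f 0 = 0" "deriv f 0 = 1"
    using f(1) by (auto simp: class_A_def)
  have wd: "cmod (w z) < 1" if "z \<in> unit_disc" for z
    using w(2) that by (auto simp: image_subset_iff)
  define F W K L where "F = fps_expansion f 0" and "W = fps_expansion w 0"
    and "K = fps_expansion (\<lambda>z. Ln (1 + w z)) 0"
    and "L = Abs_fps (\<lambda>n. if n = 0 then 0 else 2 * log_coeff g n)"
  have F: "f has_fps_expansion F" and W: "w has_fps_expansion W"
    and K: "(\<lambda>z. Ln (1 + w z)) has_fps_expansion K"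
    unfolding F_def W_def K_def using f'(1) w(1) Ln_one_plus(1)[OF wd]
    by (auto intro!: has_fps_expansion_fps_expansion[of unit_disc] holomorphic_intros)
  have F01: "fps_nth F 0 = 0" "fps_nth F 1 = 1" and W0: "fps_nth W 0 = 0" and K0: "fps_nth K 0 = 0"
    using f' w(3) by (simp_all add: F_def W_def K_def fps_expansion_def)
  have f_eq: "z * deriv f z * (1 - Ln (1 + w z)) = f z" if z: "z \<in> unit_disc" for z
  proof (cases "z = 0")
    case False
    have "z * deriv f z / f z = 1 / (1 - Ln (1 + w z))" "f z \<noteq> 0" "1 - Ln (1 + w z) \<noteq> 0"
      using fw f(2) z False Ln_one_plus(2)[OF wd[OF z]]
      by (auto simp: log_quotient_def B_fun_def split: if_splits)
    then show ?thesis by (simp add: frac_eq_eq)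
  qed (simp add: f')
  have FK: "fps_X * fps_deriv F * (1 - K) = F"
    by (rule fps_eq_if_eq_on_disc[OF _ F f_eq]) (intro fps_expansion_intros F K)
  have w_eq: "deriv (\<lambda>z. Ln (1 + w z)) z * (1 + w z) = deriv w z" if z: "z \<in> unit_disc" for z
  proof -
    have "1 + w z \<noteq> 0" using Ln_one_plus(1)[OF wd[OF z]] by auto
    have "(w has_field_derivative deriv w z) (at z)"
      using holomorphic_derivI[OF w(1) open_ball z] .
    then have "((\<lambda>z. Ln (1 + w z)) has_field_derivative deriv w z / (1 + w z)) (at z)"
      using Ln_one_plus(1)[OF wd[OF z]] by (auto intro!: derivative_eq_intros simp: divide_inverse)
    then show ?thesis using DERIV_imp_deriv \<open>1 + w z \<noteq> 0\<close> by fastforce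
  qed
  have KW: "fps_deriv K * (1 + W) = fps_deriv W"
    by (rule fps_eq_if_eq_on_disc[OF _ _ w_eq]) (rule fps_expansion_intros W K)+
  have "eventually (\<lambda>z. (\<lambda>n. fps_nth L n * z ^ n) sums log_ratio g z) (nhds 0)"
    using log_coeff_sums[OF f(1) g]
  proof eventually_elim
    case (elim z)
    then have "(\<lambda>n. fps_nth L (Suc n) * z ^ Suc n) sums log_ratio g z" by (simp add: L_def)
    then show ?case by (subst (asm) sums_Suc_iff) (simp add: L_def)
  qed
  then have L: "log_ratio g has_fps_expansion L" by (rule has_fps_expansionI)
  define E where "E = fps_exp 1 oo L"
  have "(exp \<circ> log_ratio g) has_fps_expansion E"
    unfolding E_def by (intro fps_expansion_intros L) (simp add: L_def)
  then have G': "(\<lambda>z. z * exp (log_ratio g z)) has_fps_expansion fps_X * E"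
    unfolding o_def by (intro fps_expansion_intros)
  have g0: "g 0 = 0" and "eventually (\<lambda>z. f (g z) = z) (nhds 0)"
    using g by (auto simp: local_inverse_def)
  \<comment> \<open>Where f(g(z)) = z is nonzero, so is g(z), since f(0) = 0. The exponential then
    undoes the logarithm whatever its branch.\<close>
  from this(2) have g_eq: "eventually (\<lambda>z. z * exp (log_ratio g z) = g z) (nhds 0)"
  proof (rule eventually_mono)
    fix z assume z: "f (g z) = z"
    show "z * exp (log_ratio g z) = g z"
    proof (cases "z = 0")
      case False
      then have "g z \<noteq> 0" using z f'(2) by auto
      then show ?thesis using False by (simp add: log_ratio_def)
    qed (simp add: g0)
  qed
  have G: "g has_fps_expansion fps_X * E"
    using G' unfolding has_fps_expansion_cong[OF g_eq refl] .
  have "(f \<circ> g) has_fps_expansion (F oo (fps_X * E))"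
    by (intro has_fps_expansion_compose F G) simp
  moreover have "(f \<circ> g) has_fps_expansion fps_X \<longleftrightarrow> (\<lambda>z::complex. z) has_fps_expansion fps_X"
    by (rule has_fps_expansion_cong[OF _ refl]) (use g in \<open>simp add: local_inverse_def\<close>)
  ultimately have comp: "F oo (fps_X * E) = fps_X"
    using fps_expansion_unique_complex has_fps_expansion_fps_X by blast
  have E: "fps_nth E 0 = 1" "fps_deriv E = fps_deriv L * E"
    by (simp_all add: E_def L_def fps_compose_deriv mult.commute)
  note Lc = fps_inverse_log_coeffs[OF F01 E(1) comp E(2)]
  note Fc = fps_starlike_coeffs[OF F01 K0 W0 FK KW]
  have "log_coeff g 1 = fps_nth L 1 / 2" "log_coeff g 2 = fps_nth L 2 / 2" "log_coeff g 3 = fps_nth L 3 / 2"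
    by (simp_all add: L_def)
  note lc = this[unfolded Lc Fc W_def, folded c_def]
  have G: "log_coeff g 1 = - c 1 / 2" "log_coeff g 2 = - (c 2 / 2 - 3 / 4 * (c 1)\<^sup>2) / 2"
    "log_coeff g 3 = - (c 3 / 3 - 7 / 6 * c 1 * c 2 + 31 / 36 * c 1 ^ 3) / 2"
    unfolding lc by (simp_all add: field_simps power2_eq_square power3_eq_cube)
  show ?thesis
    unfolding hankel_2_1_def G by (simp add: field_simps power2_eq_square eval_nat_numeral)
qed

text \<open>Only c3 contains y, and linearly, so the triangle inequality and |y| \<le> 1 reduce the
  claim to \<open>quadratic_schur_bound\<close>.\<close>

lemma hankel_bound:
  fixes a x y :: complex
  assumes "cmod a \<le> 1" "cmod x \<le> 1" "cmod y \<le> 1"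
    and c: "c1 = a" "c2 = (1 - (cmod a)\<^sup>2) * x"
      "c3 = (1 - (cmod a)\<^sup>2) * ((1 - (cmod x)\<^sup>2) * y - cnj a * x\<^sup>2)"
  shows "cmod (48 * c1 * c3 - 60 * c1\<^sup>2 * c2 - 36 * c2\<^sup>2 + 43 * c1 ^ 4) \<le> 43"
proof -
  define u X where "u = (cmod a)\<^sup>2" and "X = (cmod x)\<^sup>2"
  have u: "0 \<le> u" "u \<le> 1" "0 \<le> X" "X \<le> 1" using assms by (auto simp: u_def X_def power_le_one)
  have au: "a * cnj a = of_real u" using complex_norm_square[of a] by (simp add: u_def)
  define T where "T = 43 * a ^ 4 - 60 * (1 - of_real u) * a\<^sup>2 * x
    - 12 * (1 - of_real u) * (3 + of_real u) * x\<^sup>2"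
  have "48 * c1 * c3 - 60 * c1\<^sup>2 * c2 - 36 * c2\<^sup>2 + 43 * c1 ^ 4
    = T + of_real (48 * (1 - u) * (1 - X)) * (a * y)"
  proof -
    \<comment> \<open>By a conj(a) = u, the x^2 part of 48 c1 c3 merges with 36 c2^2: 48 u (1 - u) +
      36 (1 - u)^2 = 12 (1 - u) (3 + u).\<close>
    have "a * c3 = (1 - u) * ((1 - X) * (a * y) - a * cnj a * x\<^sup>2)"
      by (simp add: c u_def X_def algebra_simps)
    then have "48 * c1 * c3 = 48 * (1 - u) * ((1 - X) * (a * y) - u * x\<^sup>2)"
      unfolding c(1) au mult.assoc by simp
    then show ?thesis
      unfolding T_def c(1,2) u_def[symmetric] by (simp add: power2_eq_square algebra_simps)
  qed
  also have "cmod \<dots> \<le> cmod T + 48 * (1 - u) * (1 - X) * (cmod a * cmod y)"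
  proof -
    have "0 \<le> 48 * (1 - u) * (1 - X)" using u by simp
    then have *: "cmod (of_real (48 * (1 - u) * (1 - X)) * (a * y)) = 48 * (1 - u) * (1 - X) * (cmod a * cmod y)"
      by (simp only: norm_mult norm_of_real abs_of_nonneg)
    show ?thesis unfolding *[symmetric] by (rule norm_triangle_ineq)
  qed
  also have "\<dots> \<le> cmod T + 48 * (1 - u) * (1 - X) * (cmod a * 1)"
    using u assms by (intro add_left_mono mult_left_mono) auto
  also have "\<dots> = cmod T + 48 * (1 - u) * cmod a * (1 - X)" by simp
  also have "\<dots> \<le> 43"
    using quadratic_schur_bound[OF assms(1,2)] unfolding T_def u_def X_def .
  finally show ?thesis .
qed

text \<open>The equation z f'/f = B is solved by f(z) = z exp (integral from 0 to z of (B(t) - 1)/t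
  dt). The integrand extends analytically to 0 and has a primitive because the disc is
  convex.\<close>

lemma extremal_exists:
  obtains f where "f \<in> class_A" "\<forall>z\<in>unit_disc - {0}. f z \<noteq> 0"
    "\<forall>z\<in>unit_disc. log_quotient f z = B_fun z"
proof -
  have B: "B_fun holomorphic_on unit_disc"
    unfolding B_fun_def using Ln_one_plus by (auto intro!: holomorphic_intros)
  define h where "h z = (if z = 0 then deriv B_fun 0 else (B_fun z - B_fun 0) / (z - 0))" for z
  have h: "h holomorphic_on unit_disc"
    unfolding h_def using B by (intro pole_lemma_open) auto
  have zh: "1 + z * h z = B_fun z" for z by (simp add: h_def B_fun_def)
  obtain H where H: "\<And>z. z \<in> unit_disc \<Longrightarrow> (H has_field_derivative h z) (at z)"
    using holomorphic_convex_primitive'[OF _ _ h] by (metis at_within_open convex_ball open_ball)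
  \<comment> \<open>Subtracting \<open>H 0\<close> normalises f'(0) to 1; the exponential factor
    rules out zeros other than 0.\<close>
  define f where "f z = z * exp (H z - H 0)" for z
  have d: "(f has_field_derivative exp (H z - H 0) * B_fun z) (at z)" if "z \<in> unit_disc" for z
    unfolding f_def zh[symmetric] using H[OF that]
    by (auto intro!: derivative_eq_intros simp: algebra_simps)
  then have D: "deriv f z = exp (H z - H 0) * B_fun z" if "z \<in> unit_disc" for z
    using that DERIV_imp_deriv by blast
  have "f holomorphic_on unit_disc"
    using d by (meson holomorphic_on_open open_ball)
  then have "f \<in> class_A"
    using D[of 0] by (simp add: class_A_def f_def B_fun_def)
  moreover have "log_quotient f z = B_fun z" if "z \<in> unit_disc" for z
    using D[OF that] by (simp add: log_quotient_def f_def B_fun_def)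
  ultimately show ?thesis using that by (auto simp: f_def)
qed

theorem theorem3p6:
  shows "(\<forall>f g. f \<in> starlike_B \<and> local_inverse f g \<longrightarrow>
            cmod (hankel_2_1 (log_coeff g)) \<le> 43 / 576) \<and>
         (\<exists>f g. f \<in> starlike_B \<and> local_inverse f g \<and>
            cmod (hankel_2_1 (log_coeff g)) = 43 / 576)"
proof (intro conjI allI impI)
  fix f g assume "f \<in> starlike_B \<and> local_inverse f g"
  then obtain w where w: "w holomorphic_on unit_disc" "w ` unit_disc \<subseteq> unit_disc" "w 0 = 0"
    and fg: "f \<in> class_A" "\<forall>z\<in>unit_disc - {0}. f z \<noteq> 0" "local_inverse f g"
      "\<forall>z\<in>unit_disc. log_quotient f z = B_fun (w z)"
    by (auto simp: starlike_B_def subordinate_def)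
  obtain a x y :: complex where axy: "cmod a \<le> 1" "cmod x \<le> 1" "cmod y \<le> 1"
    "fps_nth (fps_expansion w 0) 1 = a"
    "fps_nth (fps_expansion w 0) 2 = (1 - (cmod a)\<^sup>2) * x"
    "fps_nth (fps_expansion w 0) 3 = (1 - (cmod a)\<^sup>2) * ((1 - (cmod x)\<^sup>2) * y - cnj a * x\<^sup>2)"
    using schwarz_coeffs[OF w] by metis
  show "cmod (hankel_2_1 (log_coeff g)) \<le> 43 / 576"
    unfolding hankel_eq[OF fg(1-3) w fg(4)] using hankel_bound[OF axy]
    by (simp add: norm_divide)
next
  obtain f where f: "f \<in> class_A" "\<forall>z\<in>unit_disc - {0}. f z \<noteq> 0"
    "\<forall>z\<in>unit_disc. log_quotient f z = B_fun z"
    using extremal_exists by metis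
  obtain g where g: "local_inverse f g" using local_inverse_exists[OF f(1)] by blast
  have "f \<in> starlike_B"
    unfolding starlike_B_def subordinate_def using f by (auto intro!: exI[of _ "\<lambda>z. z"])
  moreover have "fps_expansion (\<lambda>z. z) 0 = (fps_X :: complex fps)"
    using fps_expansion_unique_complex has_fps_expansion_fps_X
      has_fps_expansion_fps_expansion[OF open_UNIV UNIV_I holomorphic_on_ident] by blast
  \<comment> \<open>For the identity as Schwarz function only the term 43 c1^4 survives.\<close>
  then have *: "hankel_2_1 (log_coeff g) = 43 / 576"
    using hankel_eq[OF f(1,2) g _ _ _ f(3)] by simp
  have "cmod (hankel_2_1 (log_coeff g)) = 43 / 576" unfolding * by (simp add: norm_divide)
  ultimately show "\<exists>f g. f \<in> starlike_B \<and> local_inverse f g \<and>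
      cmod (hankel_2_1 (log_coeff g)) = 43 / 576"
    using g by blast
qed

end
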